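(* Consider the two-stage electricity market with a day-ahead market power mitigation (MPM) policy and price-taking participants described in the context, with generators $\mathcal{G}$ (cost coefficients $c_j>0$, estimation errors $\epsilon_j\ge 0$), loads $\mathcal{L}$, and aggregate demand $d=\sum_{l\in\mathcal{L}}d_l>0$. The competitive equilibrium outcome solves the social planner problem: the total outputs $g_j=g_j^d+g_j^r$, $j\in\mathcal{G}$, at a competitive equilibrium form an optimal solution of $$\min_{(g_j)_{j\in\mathcal{G}}\in\mathbb{R}^{\mathcal{G}}}\ \sum_{j\in\mathcal{G}}\frac{c_j}{2}g_j^2\quad\text{subject to}\quad \sum_{l\in\mathcal{L}}d_l=\sum_{j\in\mathcal{G}}g_j .$$
   Context: Setting. $\mathcal{G}$ is a finite nonempty set of generators and $\mathcal{L}$ a finite nonempty set of loads. Generator $j$ has cost $\frac{c_j}{2}g_j^2$, $c_j>0$, for total output $g_j=g_j^d+g_j^r\in\mathbb{R}$ (superscripts $d$, $r$: day-ahead, real-time). Load $l$ has fixed demand $d_l\in\mathbb{R}$, split as $d_l=d_l^d+d_l^r$ with $d_l^d\in\mathbb{R}$ chosen by the load. Put $d=\sum_l d_l>0$, $d^d=\sum_l d_l^d$, $d^r=\sum_l d_l^r$. Prices are $\lambda^d,\lambda^r\in\mathbb{R}$. Day-ahead stage with MPM policy. Generators do not bid. The operator estimates the cost coefficient of generator $j$ as $c_j+\epsilon_j$, $\epsilon_j\ge0$, and dispatches $g_j^d=(c_j+\epsilon_j)^{-1}\lambda^d$; the balance $\sum_j g_j^d=d^d$ gives $\lambda^d=d^d/\sum_{j}(c_j+\epsilon_j)^{-1}$.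 Real-time stage. Generator $j$ bids a slope $\theta_j^r\in\mathbb{R}$ and is dispatched $g_j^r=\theta_j^r\lambda^r$. The market clears when $\sum_j\theta_j^r\lambda^r=d^r$. Degenerate case: if $\sum_j\theta_j^r\lambda^r=0$ and $d^r=0$, the price $\lambda^r$ is set equal to $\lambda^d$. Price-taking participants. With $\omega_j:=\frac{(c_j+\epsilon_j)^{-1}}{\sum_k(c_k+\epsilon_k)^{-1}}$ (so that $g_j^d=\omega_j d^d$), generator $j$, taking $\lambda^r$ and its day-ahead dispatch as given, chooses $\theta_j^r\in\mathbb{R}$ to maximize $$\pi_j=(c_j+\epsilon_j)(\omega_j d^d)^2+\theta_j^r(\lambda^r)^2-\tfrac{c_j}{2}\left(\omega_j d^d+\theta_j^r\lambda^r\right)^2 .$$ Load $l$, taking $\lambda^d,\lambda^r$ as given, chooses $d_l^d\in\mathbb{R}$ to minimize $\rho_l=\lambda^d d_l^d+\lambda^r(d_l-d_l^d)$. A competitive equilibrium is a collection of bids $(\theta_j^r)_j$, allocations $(d_l^d,d_l^r)_l$ and prices $(\lambda^d,\lambda^r)$ such that every generator's bid maximizes its profit given prices, every load's allocation minimizes its payment given prices, and supply equals demand in both stages, where $\lambda^d=d^d/\sum_{j}(c_j+\epsilon_j)^{-1}$ and $\lambda^r$ satisfies the real-time clearing condition $\sum_j\theta_j^r\lambda^r=d^r$ (with $\lambda^r=\lambda^d$ in the degenerate case $\sum_j\theta_j^r\lambda^r=0$, $d^r=0$). *)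

theory Defs
  imports Complex_Main
begin

text \<open>
  Generators and loads are the elements of finite types \<open>'g\<close> and \<open>'l\<close> (nonempty, as all types are),
  so that \<open>'g \<Rightarrow> real\<close> is the whole decision space of the planner. Throughout, \<open>c\<close> and \<open>\<epsilon>\<close> are the true
  cost coefficients and their estimation errors, \<open>dem\<close> is the demand of each load with day-ahead and
  real-time parts \<open>dD\<close> and \<open>dR\<close>, \<open>\<theta>\<close> is the vector of real-time bids, and \<open>lamD\<close>, \<open>lamR\<close> are the prices.
\<close>

definition aggregate :: "('a::finite \<Rightarrow> real) \<Rightarrow> real" where
  "aggregate x = (\<Sum>i\<in>UNIV. x i)"

definition gen_cost :: "('g \<Rightarrow> real) \<Rightarrow> 'g \<Rightarrow> real \<Rightarrow> real" where
  "gen_cost c j x = c j / 2 * x\<^sup>2"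

definition da_dispatch :: "('g \<Rightarrow> real) \<Rightarrow> ('g \<Rightarrow> real) \<Rightarrow> real \<Rightarrow> 'g \<Rightarrow> real" where
  "da_dispatch c \<epsilon> lamD j = inverse (c j + \<epsilon> j) * lamD"

definition rt_dispatch :: "('g \<Rightarrow> real) \<Rightarrow> real \<Rightarrow> 'g \<Rightarrow> real" where
  "rt_dispatch \<theta> lamR j = \<theta> j * lamR"

definition total_output ::
  "('g \<Rightarrow> real) \<Rightarrow> ('g \<Rightarrow> real) \<Rightarrow> ('g \<Rightarrow> real) \<Rightarrow> real \<Rightarrow> real \<Rightarrow> 'g \<Rightarrow> real" where
  "total_output c \<epsilon> \<theta> lamD lamR j = da_dispatch c \<epsilon> lamD j + rt_dispatch \<theta> lamR j"

definition da_share :: "('g::finite \<Rightarrow> real) \<Rightarrow> ('g \<Rightarrow> real) \<Rightarrow> 'g \<Rightarrow> real" where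
  "da_share c \<epsilon> j = inverse (c j + \<epsilon> j) / (\<Sum>k\<in>UNIV. inverse (c k + \<epsilon> k))"

text \<open>
  Profit of generator \<open>j\<close> as a function of its own real-time bid \<open>t\<close>. The aggregate day-ahead demand
  \<open>D\<close> (hence the day-ahead dispatch \<open>da_share c \<epsilon> j * D\<close>) and the real-time price are parameters: this
  is what price taking means here.
\<close>

definition gen_profit ::
  "('g::finite \<Rightarrow> real) \<Rightarrow> ('g \<Rightarrow> real) \<Rightarrow> real \<Rightarrow> real \<Rightarrow> 'g \<Rightarrow> real \<Rightarrow> real" where
  "gen_profit c \<epsilon> D lamR j t =
     (c j + \<epsilon> j) * (da_share c \<epsilon> j * D)\<^sup>2 + t * lamR\<^sup>2 - gen_cost c j (da_share c \<epsilon> j * D + t * lamR)"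

definition load_payment :: "('l \<Rightarrow> real) \<Rightarrow> real \<Rightarrow> real \<Rightarrow> 'l \<Rightarrow> real \<Rightarrow> real" where
  "load_payment dem lamD lamR l x = lamD * x + lamR * (dem l - x)"

definition da_clearing ::
  "('g::finite \<Rightarrow> real) \<Rightarrow> ('g \<Rightarrow> real) \<Rightarrow> ('l::finite \<Rightarrow> real) \<Rightarrow> real \<Rightarrow> bool" where
  "da_clearing c \<epsilon> dD lamD \<longleftrightarrow>
     lamD = aggregate dD / (\<Sum>j\<in>UNIV. inverse (c j + \<epsilon> j)) \<and>
     aggregate (da_dispatch c \<epsilon> lamD) = aggregate dD"

text \<open>
  When no energy is traded in real time, the balance equation alone need not determine the real-time
  price, which is then set to the day-ahead price.
\<close>

definition rt_clearing ::
  "('g::finite \<Rightarrow> real) \<Rightarrow> ('l::finite \<Rightarrow> real) \<Rightarrow> real \<Rightarrow> real \<Rightarrow> bool" where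
  "rt_clearing \<theta> dR lamD lamR \<longleftrightarrow>
     aggregate (rt_dispatch \<theta> lamR) = aggregate dR \<and>
     (aggregate (rt_dispatch \<theta> lamR) = 0 \<and> aggregate dR = 0 \<longrightarrow> lamR = lamD)"

definition competitive_equilibrium ::
  "('g::finite \<Rightarrow> real) \<Rightarrow> ('g \<Rightarrow> real) \<Rightarrow> ('l::finite \<Rightarrow> real) \<Rightarrow>
   ('g \<Rightarrow> real) \<Rightarrow> ('l \<Rightarrow> real) \<Rightarrow> ('l \<Rightarrow> real) \<Rightarrow> real \<Rightarrow> real \<Rightarrow> bool" where
  "competitive_equilibrium c \<epsilon> dem \<theta> dD dR lamD lamR \<longleftrightarrow>
     (\<forall>j. is_arg_max (gen_profit c \<epsilon> (aggregate dD) lamR j) (\<lambda>t. True) (\<theta> j)) \<and>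
     (\<forall>l. is_arg_min (load_payment dem lamD lamR l) (\<lambda>x. True) (dD l)) \<and>
     (\<forall>l. dem l = dD l + dR l) \<and>
     da_clearing c \<epsilon> dD lamD \<and>
     rt_clearing \<theta> dR lamD lamR"

definition planner_optimal :: "('g::finite \<Rightarrow> real) \<Rightarrow> ('l::finite \<Rightarrow> real) \<Rightarrow> ('g \<Rightarrow> real) \<Rightarrow> bool" where
  "planner_optimal c dem g \<longleftrightarrow>
     is_arg_min (\<lambda>g. \<Sum>j\<in>UNIV. gen_cost c j (g j)) (\<lambda>g. aggregate dem = aggregate g) g"

end

theory Submission imports Defs begin

text \<open>
  Loads can shift demand freely between the stages, so an equilibrium forces both prices to a common
  value \<open>p\<close>, which is nonzero because total demand is. A generator can then reach any total output by
  its bid, so it equates its marginal cost with \<open>p\<close>. Thus \<open>p\<close> is a Lagrange multiplier of the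
  balance constraint, and convexity of the costs gives optimality.
\<close>

lemma load_optimal_imp_prices_eq:
  assumes "is_arg_min (load_payment dem lamD lamR l) (\<lambda>x. True) x"
  shows "lamD = lamR"
proof -
  have "load_payment dem lamD lamR l x \<le> load_payment dem lamD lamR l y" for y
    using assms by (simp add: is_arg_min_linorder)
  \<comment> \<open>The payment is affine with slope \<open>lamD - lamR\<close>, so shifting one
    unit in either direction bounds the slope from both sides by zero.\<close>
  from this[of "x + 1"] this[of "x - 1"] show ?thesis
    by (simp add: load_payment_def algebra_simps)
qed

text \<open>Comparing the optimal bid with the one bid that equates marginal cost and price replaces
  differentiation: profit is quadratic in the bid, so the loss is an exact square.\<close>

lemma gen_optimal_imp_marginal_cost_eq_price:
  assumes "c j > 0" and "lamR \<noteq> 0"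
    and opt: "is_arg_max (gen_profit c \<epsilon> D lamR j) (\<lambda>t. True) t"
  shows "c j * (da_share c \<epsilon> j * D + t * lamR) = lamR"
proof -
  define q where "q = da_share c \<epsilon> j * D"
  \<comment> \<open>The bid whose total output is \<open>lamR / c j\<close>, where marginal cost
    equals the price.\<close>
  define s where "s = (lamR / c j - q) / lamR"
  have s: "s * lamR = lamR / c j - q"
    using \<open>lamR \<noteq> 0\<close> by (simp add: s_def)
  \<comment> \<open>The change in output when the bid moves from \<open>t\<close> to
    \<open>s\<close>.\<close>
  define \<delta> where "\<delta> = lamR / c j - (q + t * lamR)"
  have lam: "lamR = c j * (q + t * lamR + \<delta>)"
    using \<open>c j > 0\<close> by (simp add: \<delta>_def)
  have "gen_profit c \<epsilon> D lamR j s \<le> gen_profit c \<epsilon> D lamR j t"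
    using opt by (simp add: is_arg_max_linorder)
  then have "s * lamR * lamR - c j / 2 * (q + s * lamR)\<^sup>2
      \<le> t * lamR * lamR - c j / 2 * (q + t * lamR)\<^sup>2"
    by (simp add: gen_profit_def gen_cost_def q_def[symmetric] power2_eq_square mult.assoc)
  moreover have "s * lamR = t * lamR + \<delta>"
    by (simp add: s \<delta>_def)
  ultimately have "\<delta> * lamR \<le> c j / 2 * ((q + t * lamR + \<delta>)\<^sup>2 - (q + t * lamR)\<^sup>2)"
    by (simp add: algebra_simps)
  \<comment> \<open>Expanding around the output at \<open>s\<close> makes the linear coefficient
    equal to \<open>lamR\<close>, so the linear term cancels against the left-hand side.\<close>
  also have "\<dots> = \<delta> * (c j * (q + t * lamR + \<delta>)) - c j / 2 * \<delta>\<^sup>2"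
    by (simp add: power2_eq_square field_simps)
  finally have "c j / 2 * \<delta>\<^sup>2 \<le> 0"
    by (simp add: lam[symmetric])
  then have "\<delta> = 0"
    using \<open>c j > 0\<close> by (simp add: mult_le_0_iff)
  then show ?thesis
    using lam by (simp add: q_def)
qed

text \<open>Each convex cost lies above its tangent at \<open>g j\<close>. All tangents have slope
  \<open>p\<close>, so their linear terms cancel in the sum over any feasible deviation.\<close>

lemma planner_optimalI:
  fixes c g :: "'g::finite \<Rightarrow> real"
  assumes "\<And>j. c j \<ge> 0"
    and feasible: "aggregate dem = aggregate g"
    and marginal: "\<And>j. c j * g j = p"
  shows "planner_optimal c dem g"
  unfolding planner_optimal_def is_arg_min_linorder
proof (intro conjI allI impI feasible)
  fix h :: "'g \<Rightarrow> real"
  assume h: "aggregate dem = aggregate h"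
  have "gen_cost c j (g j) + p * (h j - g j) \<le> gen_cost c j (h j)" for j
  proof -
    have "gen_cost c j (h j) - gen_cost c j (g j) - c j * g j * (h j - g j)
        = c j / 2 * (h j - g j)\<^sup>2"
      by (simp add: gen_cost_def power2_eq_square field_simps)
    moreover have "\<dots> \<ge> 0"
      using assms(1)[of j] by simp
    ultimately show ?thesis
      by (simp add: marginal)
  qed
  then have "(\<Sum>j\<in>UNIV. gen_cost c j (g j) + p * (h j - g j)) \<le> (\<Sum>j\<in>UNIV. gen_cost c j (h j))"
    by (rule sum_mono)
  moreover have "(\<Sum>j\<in>UNIV. p * (h j - g j)) = 0"
    using feasible h by (simp add: aggregate_def sum_subtractf flip: sum_distrib_left)
  ultimately show "(\<Sum>j\<in>UNIV. gen_cost c j (g j)) \<le> (\<Sum>j\<in>UNIV. gen_cost c j (h j))"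
    by (simp add: sum.distrib)
qed

theorem mainTheorem4:
  fixes c \<epsilon> \<theta> :: "'g::finite \<Rightarrow> real"
    and dem dD dR :: "'l::finite \<Rightarrow> real"
    and lamD lamR :: real
  assumes "\<And>j. c j > 0"
    and "\<And>j. \<epsilon> j \<ge> 0"
    and "aggregate dem > 0"
    and "competitive_equilibrium c \<epsilon> dem \<theta> dD dR lamD lamR"
  shows "planner_optimal c dem (total_output c \<epsilon> \<theta> lamD lamR)"
proof -
  have gen: "is_arg_max (gen_profit c \<epsilon> (aggregate dD) lamR j) (\<lambda>t. True) (\<theta> j)"
    and load: "is_arg_min (load_payment dem lamD lamR l) (\<lambda>x. True) (dD l)"
    and split: "dem l = dD l + dR l"
    and da: "da_clearing c \<epsilon> dD lamD"
    and rt: "rt_clearing \<theta> dR lamD lamR" for j l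
    using assms(4) by (auto simp: competitive_equilibrium_def)
  have prices: "lamD = lamR"
    by (rule load_optimal_imp_prices_eq[OF load])
  have balance: "aggregate dem = aggregate (total_output c \<epsilon> \<theta> lamD lamR)"
  proof -
    have "aggregate (da_dispatch c \<epsilon> lamD) = aggregate dD"
      and "aggregate (rt_dispatch \<theta> lamR) = aggregate dR"
      using da rt unfolding da_clearing_def rt_clearing_def by blast+
    then show ?thesis
      by (simp add: aggregate_def total_output_def split sum.distrib)
  qed
  have "lamR \<noteq> 0"
  proof
    \<comment> \<open>With both prices zero nothing is dispatched in either stage, although demand
      is positive.\<close>
    assume "lamR = 0"
    with prices have "aggregate (total_output c \<epsilon> \<theta> lamD lamR) = 0"
      by (simp add: aggregate_def total_output_def da_dispatch_def rt_dispatch_def)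
    with balance assms(3) show False by simp
  qed
  \<comment> \<open>This identifies the dispatch set by the day-ahead price with the share form in
    which \<open>gen_profit\<close> is written.\<close>
  moreover have "da_dispatch c \<epsilon> lamD j = da_share c \<epsilon> j * aggregate dD" for j
    using da by (simp add: da_clearing_def da_dispatch_def da_share_def)
  ultimately have "c j * total_output c \<epsilon> \<theta> lamD lamR j = lamR" for j
    using gen_optimal_imp_marginal_cost_eq_price[OF assms(1) _ gen]
    by (simp add: total_output_def rt_dispatch_def)
  then show ?thesis
    using assms(1) balance by (intro planner_optimalI) (auto intro: less_imp_le)
qed

end
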